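(* Let $D$ be a unique factorization domain with at least one prime element and with finitely many units. Then $D$ has infinitely many prime elements. *)

theory Defs
  imports "HOL-Algebra.Ring_Divisibility"
begin

end

theory Submission
  imports Defs
begin

text \<open>
  This is Euclid's argument. If there were only finitely many primes, some nonzero \<open>x\<close> would be
  divisible by all of them (\<open>finite_nonzero_common_multiple\<close>), and then no prime divides an element
  of the form \<open>\<one> \<oplus> x \<otimes> y\<close>. Every element that is neither zero nor a unit has a prime divisor
  (\<open>ring_prime_divisor_exists\<close>), so all these elements are zero or units.
  Over the integers one concludes by size; here size is replaced by counting. Since at least one
  prime exists, \<open>x\<close> is not a unit, so its powers are pairwise distinct
  (\<open>inj_nat_pow_nonunit\<close>) and the elements \<open>\<one> \<oplus> x \<otimes> x\<^sup>n\<close> form an infinite set, which does not fit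
  into the finite set consisting of zero and the units.
\<close>

lemma (in domain) finite_nonzero_common_multiple:
  assumes "finite A" "A \<subseteq> carrier R - {\<zero>}"
  shows "\<exists>x \<in> carrier R - {\<zero>}. \<forall>a \<in> A. a divides x"
  using assms
proof (induction A)
  case empty
  show ?case using one_closed one_not_zero by blast
next
  case (insert a A)
  then obtain x where x: "x \<in> carrier R - {\<zero>}" "\<forall>b \<in> A. b divides x"
    by auto
  have a: "a \<in> carrier R - {\<zero>}" using insert.prems by simp
  have "a \<otimes> x \<in> carrier R - {\<zero>}" using a x(1) by (simp add: integral_iff)
  moreover have "a divides (a \<otimes> x)" using a x(1) by blast
  moreover have "b divides (a \<otimes> x)" if "b \<in> A" for b
    using that a x insert.prems by (intro divides_prod_l) auto
  ultimately show ?case by blast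
qed

text \<open>
  A coincidence \<open>x\<^sup>m = x\<^sup>n\<close> with \<open>m < n\<close> cancels to \<open>\<one> = x\<^sup>n\<^sup>-\<^sup>m\<close>, which exhibits an inverse of \<open>x\<close>.
\<close>
lemma (in domain) inj_nat_pow_nonunit:
  assumes x: "x \<in> carrier R" "x \<noteq> \<zero>" and nonunit: "x \<notin> Units R"
  shows "inj (\<lambda>n::nat. x [^] n)"
proof (rule linorder_injI)
  fix m n :: nat
  assume "m < n"
  then obtain k where k: "n = m + Suc k" using less_imp_Suc_add by auto
  show "x [^] m \<noteq> x [^] n"
  proof
    assume "x [^] m = x [^] n"
    also have "x [^] n = x [^] m \<otimes> x [^] Suc k"
      unfolding k using nat_pow_mult[OF x(1), of m "Suc k"] by (rule sym)
    finally have "x [^] m \<otimes> \<one> = x [^] m \<otimes> x [^] Suc k"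
      using x(1) by simp
    moreover have "x [^] m \<noteq> \<zero>"
      using x by (induction m) (auto simp: integral_iff)
    ultimately have "\<one> = x [^] Suc k"
      using m_lcancel[of "x [^] m" \<one> "x [^] Suc k"] nat_pow_closed[OF x(1)] one_closed
      by blast
    then have "\<one> = x \<otimes> x [^] k"
      using x by (simp add: m_comm)
    then have "x divides \<one>"
      using x(1) by (blast intro: dividesI)
    then show False using nonunit x(1) divides_one by blast
  qed
qed

lemma (in factorial_domain) ring_prime_divisor_exists:
  assumes a: "a \<in> carrier R" "a \<noteq> \<zero>" and nonunit: "a \<notin> Units R"
  shows "\<exists>p \<in> carrier R. ring_prime p \<and> p divides a"
proof -
  have a': "a \<in> carrier (mult_of R)" "a \<notin> Units (mult_of R)" using assms by auto
  then obtain fs where fs: "set fs \<subseteq> carrier (mult_of R)" "factors (mult_of R) fs a"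
    using factors_exist by blast
  have "fs \<noteq> []"
  proof
    \<comment> \<open>The empty product is \<open>\<one>\<close>, which is a unit.\<close>
    assume "fs = []"
    then have "a = \<one>" using fs(2) by (simp add: factors_def)
    then show False using nonunit by simp
  qed
  then obtain p where p: "p \<in> set fs" by (cases fs) auto
  have pc: "p \<in> carrier R" "p \<noteq> \<zero>" using p fs(1) by auto
  have "irreducible (mult_of R) p" using p fs(2) by (simp add: factors_def)
  then have "prime (mult_of R) p" using irreducible_prime pc by simp
  then have "ring_prime p" using pc prime_eq_prime_mult by (simp add: ring_prime_def)
  moreover have "p divides a"
    using mult_of.factors_dividesI[OF fs(2) p fs(1)] by simp
  ultimately show ?thesis using pc by blast
qed

theorem proposition4p1:
  fixes D (structure)
  assumes "factorial_domain D"
    and "\<exists>p \<in> carrier D. ring_prime p"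
    and "finite (Units D)"
  shows "infinite {p \<in> carrier D. ring_prime p}"
proof
  interpret factorial_domain D by fact
  let ?P = "{p \<in> carrier D. ring_prime p}"
  assume "finite ?P"
  moreover have "?P \<subseteq> carrier D - {\<zero>}" by (auto simp: ring_prime_def)
  ultimately obtain x where x: "x \<in> carrier D" "x \<noteq> \<zero>"
    and P_dvd: "\<And>p. p \<in> ?P \<Longrightarrow> p divides x"
    using finite_nonzero_common_multiple[of ?P] by blast
  have prime_nonunit: "\<not> p divides \<one>" if "p \<in> ?P" for p
    using that divides_one by (auto simp: ring_prime_def prime_def)
  have "x \<notin> Units D"
  proof
    assume unit: "x \<in> Units D"
    obtain p where p: "p \<in> ?P" using assms(2) by blast
    have "p divides \<one>"
    proof (rule divides_trans)
      show "p divides x" using p by (rule P_dvd)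
      show "x divides \<one>" using unit x(1) divides_one by blast
      show "p \<in> carrier D" using p by simp
    qed
    then show False using prime_nonunit p by blast
  qed
  then have pow_inj: "inj (\<lambda>n::nat. x [^] n)" using x inj_nat_pow_nonunit by blast

  define f where "f n = \<one> \<oplus> x \<otimes> x [^] n" for n :: nat
  have f_closed: "f n \<in> carrier D" for n using x by (simp add: f_def)
  have "inj f"
  proof (rule injI)
    fix m n assume "f m = f n"
    then have "x \<otimes> x [^] m = x \<otimes> x [^] n"
      using x(1) unfolding f_def by (simp add: add.l_cancel)
    then have "x [^] m = x [^] n"
      using x by (simp add: m_lcancel)
    then show "m = n" using pow_inj by (simp add: inj_eq)
  qed
  then have "infinite (range f)" by (rule range_inj_infinite)
  then have "\<not> range f \<subseteq> insert \<zero> (Units D)"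
    using assms(3) finite_subset by blast
  then obtain n where n: "f n \<noteq> \<zero>" "f n \<notin> Units D" by auto
  then obtain p where p: "p \<in> carrier D" "ring_prime p" "p divides f n"
    using ring_prime_divisor_exists f_closed by blast
  obtain c where c: "c \<in> carrier D" "f n = p \<otimes> c" using p(3) by (auto simp: factor_def)
  obtain d where d: "d \<in> carrier D" "x = p \<otimes> d"
    using P_dvd[of p] p by (auto simp: factor_def)
  have x_pow: "x [^] n \<in> carrier D" using x(1) by simp
  have "\<one> = f n \<ominus> x \<otimes> x [^] n"
    using x by (simp add: f_def a_minus_def a_assoc r_neg)
  also have "\<dots> = p \<otimes> c \<ominus> p \<otimes> (d \<otimes> x [^] n)"
    using c(2) d p(1) by (simp add: m_assoc x_pow)
  also have "\<dots> = p \<otimes> (c \<ominus> d \<otimes> x [^] n)"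
    using c d p(1) x(1) by (simp add: a_minus_def r_distr r_minus)
  finally have "p divides \<one>"
    using c(1) d(1) p(1) x_pow by (intro dividesI[of "c \<ominus> d \<otimes> x [^] n"]) auto
  then show False using prime_nonunit p by blast
qed

end
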